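(* Let $n=1$, $s\in(0,1)$ and $\alpha\in(0,1)$. There exist $\bar m=\bar m(\alpha,s)>0$ and $C_o>0$, with $C_o$ independent of $m$, such that for every $m\in(0,\bar m)$ there exists a bounded (volume-constrained) critical point $E_\star\subset\mathbb{R}$ of $F$ with volume $|E_\star|=m$, made of two disconnected components, whose diameter satisfies $$\mathrm{diam}(E_\star)\ge C_o.$$ Equivalently, there exist $\bar\varepsilon=\bar\varepsilon(\alpha,s)>0$ and $C_o>0$, with $C_o$ independent of $\varepsilon$, such that for every $\varepsilon\in(0,\bar\varepsilon)$ there exist a bounded set $E\subset\mathbb{R}$ with $|E|=1$, made of two disconnected components, and a number $\lambda_\varepsilon\in\mathbb{R}$ such that $$\kappa_E(x)+c\,\varepsilon\,V_E(x)=\lambda_\varepsilon\qquad\text{for every }x\in\partial E,$$ and $$\mathrm{diam}(E)\ge C_o\,\varepsilon^{-\frac{1}{1+s-\alpha}}.$$ In particular, the diameter of $E$ is not bounded uniformly in $\varepsilon$.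
   Context: Here $n=1$. For $E\subset\mathbb{R}$, $|E|$ is its Lebesgue measure (volume), $E^c=\mathbb{R}\setminus E$, and $$P_s(E):=\iint_{E\times E^c}\frac{dx\,dy}{|x-y|^{1+s}},\qquad F(E):=P_s(E)+\iint_{E\times E}\frac{dx\,dy}{|x-y|^{\alpha}},$$ $$V_E(x):=\int_E\frac{dy}{|x-y|^{\alpha}},\qquad \kappa_E(x):=\int_{\mathbb{R}}\frac{\chi_{\mathbb{R}\setminus E}(y)-\chi_E(y)}{|x-y|^{1+s}}\,dy,$$ the last integral being in the principal value sense. A set made of two disconnected components is a union of two open intervals with disjoint closures. A volume-constrained critical point of $F$ is a set $E$ such that $\frac{d}{dt}F(\Phi^t(E))\big|_{t=0}=0$ for every vector field $X\in C_c^\infty(\mathbb{R})$ whose flow $\Phi^t$ ($\partial_t\Phi^t=X(\Phi^t)$, $\Phi^0=\mathrm{Id}$) satisfies $|\Phi^t(E)|=|E|$ for all small $t$; for a finite union of bounded open intervals with disjoint closures this amounts to the existence of $\lambda\in\mathbb{R}$ with $\kappa_E+c\,V_E=\lambda$ on $\partial E$. The constant $c>0$ is the normalizing constant in the Euler--Lagrange equation ($c=2$ with the normalizations above). *)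

theory Defs
  imports "HOL-Analysis.Analysis"
begin

(* The double integrals have nonnegative integrands and are taken in [0,\<infinity>], so that no
   integrability convention can interfere.  The kernel takes the value 0 (division by zero) on
   the diagonal, which is a null set in E \<times> E and does not meet E \<times> (- E). *)

definition frac_perimeter :: "real \<Rightarrow> real set \<Rightarrow> ennreal" where
  "frac_perimeter s E =
     (\<integral>\<^sup>+ p \<in> E \<times> (- E). ennreal (1 / \<bar>fst p - snd p\<bar> powr (1 + s)) \<partial>lebesgue)"

definition riesz_energy :: "real \<Rightarrow> real set \<Rightarrow> ennreal" where
  "riesz_energy \<alpha> E =
     (\<integral>\<^sup>+ p \<in> E \<times> E. ennreal (1 / \<bar>fst p - snd p\<bar> powr \<alpha>) \<partial>lebesgue)"

definition energy :: "real \<Rightarrow> real \<Rightarrow> real set \<Rightarrow> ennreal" where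
  "energy s \<alpha> E = frac_perimeter s E + riesz_energy \<alpha> E"

(* For bounded measurable E and 0 < \<alpha> < 1 the integrand is integrable, so the Bochner
   integral is the intended value. *)

definition riesz_potential :: "real \<Rightarrow> real set \<Rightarrow> real \<Rightarrow> real" where
  "riesz_potential \<alpha> E x = (LINT y:E|lebesgue. 1 / \<bar>x - y\<bar> powr \<alpha>)"

(* The principal value is a relation, so that its existence is part of what is asserted:
   "has_frac_curvature s E x k" says that the truncated integrals converge to k.
   Each truncated integrand is integrable for measurable E and s > 0. *)

definition has_frac_curvature :: "real \<Rightarrow> real set \<Rightarrow> real \<Rightarrow> real \<Rightarrow> bool" where
  "has_frac_curvature s E x k \<longleftrightarrow>
     ((\<lambda>\<delta>. LINT y:{y. \<delta> < \<bar>x - y\<bar>}|lebesgue.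
          (indicator (- E) y - indicator E y) / \<bar>x - y\<bar> powr (1 + s)) \<longlongrightarrow> k) (at_right 0)"

definition test_field :: "(real \<Rightarrow> real) \<Rightarrow> bool" where
  "test_field X \<longleftrightarrow>
     (\<forall>k x. (deriv ^^ k) X differentiable (at x)) \<and> compact (closure {x. X x \<noteq> 0})"

definition is_flow :: "(real \<Rightarrow> real) \<Rightarrow> (real \<Rightarrow> real \<Rightarrow> real) \<Rightarrow> bool" where
  "is_flow X \<Phi> \<longleftrightarrow>
     (\<forall>x. \<Phi> 0 x = x) \<and>
     (\<forall>t x. ((\<lambda>\<tau>. \<Phi> \<tau> x) has_real_derivative X (\<Phi> t x)) (at t))"

(* The energy is required to be finite along the flow for small times, so that the conversion
   to real numbers is harmless.  A test field has exactly one flow, hence quantifying over all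
   \<Phi> with is_flow X \<Phi> amounts to taking the flow of X. *)

definition volume_constrained_critical :: "real \<Rightarrow> real \<Rightarrow> real set \<Rightarrow> bool" where
  "volume_constrained_critical s \<alpha> E \<longleftrightarrow>
     E \<in> sets lebesgue \<and>
     (\<forall>X \<Phi>. test_field X \<longrightarrow> is_flow X \<Phi> \<longrightarrow>
        (\<forall>\<^sub>F t in nhds 0. emeasure lebesgue (\<Phi> t ` E) = emeasure lebesgue E) \<longrightarrow>
        (\<forall>\<^sub>F t in nhds 0. energy s \<alpha> (\<Phi> t ` E) < \<infinity>) \<and>
        ((\<lambda>t. enn2real (energy s \<alpha> (\<Phi> t ` E))) has_real_derivative 0) (at 0))"

(* On the real line, open intervals (possibly unbounded) are the open sets with is_interval. *)

definition two_components :: "real set \<Rightarrow> bool" where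
  "two_components E \<longleftrightarrow>
     (\<exists>I J. open I \<and> is_interval I \<and> I \<noteq> {} \<and> open J \<and> is_interval J \<and> J \<noteq> {} \<and>
            closure I \<inter> closure J = {} \<and> E = I \<union> J)"

(* The equation \<kappa>_E + c \<epsilon> V_E = \<lambda> on the boundary, with c = 2: by symmetry of the kernel the
   first variation of riesz_energy is twice the boundary integral of the potential, whereas
   frac_perimeter counts each pair in E \<times> (- E) once. *)

definition euler_lagrange :: "real \<Rightarrow> real \<Rightarrow> real \<Rightarrow> real set \<Rightarrow> real \<Rightarrow> bool" where
  "euler_lagrange s \<alpha> \<epsilon> E \<mu> \<longleftrightarrow>
     (\<forall>x \<in> frontier E. \<exists>k. has_frac_curvature s E x k \<and> k + 2 * \<epsilon> * riesz_potential \<alpha> E x = \<mu>)"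

end

(* For two equal intervals of length L separated by a gap A, symmetric about 0, both the energy and
   the Euler-Lagrange equation are explicit, with the same endpoint function
   f r = r^-s / s + \<epsilon> r^(1 - \<alpha>) / (1 - \<alpha>).  By symmetry the equation reduces to the vanishing of the
   second difference f A + f (A + 2 L) - 2 f (A + L), which equals L^2 f'' at an intermediate point.
   Since f'' changes sign from plus to minus at R = ((1 + s) / (\<alpha> \<epsilon>))^(1 / (1 + s - \<alpha>)), the intermediate
   value theorem yields a solution A in [R - 2 L, R], so the diameter A + 2 L is at least R.
   The two parts are the cases \<epsilon> = 1, L = m / 2 and L = 1 / 2. *)

theory Submission
  imports Defs
begin

subsection \<open>Integrals of power kernels\<close>

text \<open>The second difference is the force that separates the two intervals: where f is convex
  the perimeter dominates and they attract, where f is concave the Riesz term dominates and they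
  repel. The crossover distance R does not depend on L, so shrinking the intervals does not shrink
  the diameter.

  Two obstacles shape the computation. The kernel of order 1 + s is not integrable up to a boundary
  point, so the inner integrals blow up where E touches its complement; the double integrals stay
  finite because the second antiderivative of r^-(1+s) is a multiple of r^(1-s), which tends to 0 at
  0. Moreover the energy lives in [0,\<infinity>], where terms cannot be subtracted freely, so every
  explicit value is accompanied by a proof that it is nonnegative.

  Criticality is tested against all admissible flows, not only symmetric ones. A flow of the line
  maps intervals to intervals, so only the velocities of four endpoints matter, and balance makes
  the energy gradient a multiple of the volume gradient.\<close>

lemma has_integral_isometry_nonneg:
  fixes f :: "real \<Rightarrow> real"
  assumes I: "(f has_integral I) S" and S: "S \<in> sets borel" and nonneg: "\<And>y. y \<in> S \<Longrightarrow> 0 \<le> f y"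
    and a: "\<bar>a\<bar> = 1"
  shows "((\<lambda>y. f (c + a * y)) has_integral I) {y. c + a * y \<in> S}"
proof -
  let ?T = "{y. c + a * y \<in> S}"
  have T: "?T \<in> sets lebesgue"
    using measurable_sets_borel [OF _ S, of "\<lambda>y. c + a * y"] by (simp add: vimage_def)
  have "c + a * (a * (y - c)) = y" for y
    using a by (auto simp: abs_if split: if_splits)
  then have im: "(\<lambda>y. c + a * y) ` ?T = S"
    by (auto simp: image_iff) metis
  \<comment> \<open>The change of variables theorem asks for absolute integrability, which
    nonnegativity supplies. The Jacobian is \<open>\<bar>a\<bar> = 1\<close>, so translations and
    reflections are both covered.\<close>
  have "f absolutely_integrable_on S \<and> integral S f = I"
    using nonnegative_absolutely_integrable_1[of f S] I nonneg by (auto simp: has_integral_iff)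
  moreover have "((\<lambda>y. c + a * y) has_field_derivative a) (at y within ?T)" for y
    by (auto intro!: derivative_eq_intros)
  moreover have "inj_on (\<lambda>y. c + a * y) ?T"
    using a by (auto simp: inj_on_def)
  ultimately have "(\<lambda>y. \<bar>a\<bar> * f (c + a * y)) absolutely_integrable_on ?T \<and>
      integral ?T (\<lambda>y. \<bar>a\<bar> * f (c + a * y)) = I"
    using has_absolute_integral_change_of_variables_1' [OF T, of "\<lambda>y. c + a * y" "\<lambda>_. a" f I]
    unfolding im by blast
  then show ?thesis
    using a by (auto simp: has_integral_iff absolutely_integrable_on_def)
qed

text \<open>For \<open>\<gamma> < 1\<close> the antiderivative is continuous at
  \<open>y = x\<close>, so the interval may start at the singularity; for larger exponents it has to
  stay away from it.\<close>

lemma has_integral_kernel_right: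
  fixes x c d \<gamma> :: real
  assumes "x \<le> c" "c \<le> d" "\<gamma> < 1 \<or> x < c \<and> \<gamma> \<noteq> 1"
  shows "((\<lambda>y. 1 / \<bar>x - y\<bar> powr \<gamma>) has_integral
           ((d - x) powr (1 - \<gamma>) - (c - x) powr (1 - \<gamma>)) / (1 - \<gamma>)) {c<..<d}"
proof -
  have "((\<lambda>y. 1 / \<bar>x - y\<bar> powr \<gamma>) has_integral
           ((d - x) powr (1 - \<gamma>) / (1 - \<gamma>) - (c - x) powr (1 - \<gamma>) / (1 - \<gamma>))) {c..d}"
  proof (rule fundamental_theorem_of_calculus_interior)
    show "continuous_on {c..d} (\<lambda>y. (y - x) powr (1 - \<gamma>) / (1 - \<gamma>))"
      using assms by (intro continuous_intros continuous_on_powr') auto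
    show "((\<lambda>y. (y - x) powr (1 - \<gamma>) / (1 - \<gamma>)) has_vector_derivative 1 / \<bar>x - y\<bar> powr \<gamma>) (at y)"
      if "y \<in> {c<..<d}" for y
    proof -
      have "((\<lambda>y. (y - x) powr (1 - \<gamma>)) has_real_derivative (1 - \<gamma>) * (y - x) powr (1 - \<gamma> - of_nat 1) * 1) (at y)"
        using that assms by (intro DERIV_fun_powr) (auto intro!: derivative_eq_intros)
      then have "((\<lambda>y. (y - x) powr (1 - \<gamma>) / (1 - \<gamma>)) has_real_derivative
          (1 - \<gamma>) * (y - x) powr (1 - \<gamma> - of_nat 1) * 1 / (1 - \<gamma>)) (at y)"
        by (rule DERIV_cdivide)
      also have "(1 - \<gamma>) * (y - x) powr (1 - \<gamma> - of_nat 1) * 1 / (1 - \<gamma>) = 1 / \<bar>x - y\<bar> powr \<gamma>"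
        using that assms by (auto simp: powr_minus_divide)
      finally show ?thesis
        by (simp add: has_real_derivative_iff_has_vector_derivative)
    qed
  qed (use assms in auto)
  then show ?thesis
    by (simp add: has_integral_Icc_iff_Ioo diff_divide_distrib)
qed

lemma has_integral_kernel_left:
  fixes x c d \<gamma> :: real
  assumes "d \<le> x" "c \<le> d" "\<gamma> < 1 \<or> d < x \<and> \<gamma> \<noteq> 1"
  shows "((\<lambda>y. 1 / \<bar>x - y\<bar> powr \<gamma>) has_integral
           ((x - c) powr (1 - \<gamma>) - (x - d) powr (1 - \<gamma>)) / (1 - \<gamma>)) {c<..<d}"
proof -
  have "{y. 2 * x + - 1 * y \<in> {2 * x - d<..<2 * x - c}} = {c<..<d}"
    by auto
  moreover have "2 * x + - 1 * y - x = x - y" for y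
    by simp
  ultimately show ?thesis
    using has_integral_isometry_nonneg
      [OF has_integral_kernel_right [of x "2 * x - d" "2 * x - c" \<gamma>], where c = "2 * x" and a = "- 1"] assms
    by (simp add: abs_minus_commute)
qed

lemma has_integral_kernel_right_inf:
  fixes x c \<gamma> :: real
  assumes "x < c" "\<gamma> > 1"
  shows "((\<lambda>y. 1 / \<bar>x - y\<bar> powr \<gamma>) has_integral (c - x) powr (1 - \<gamma>) / (\<gamma> - 1)) {c<..}"
proof -
  have "((\<lambda>y. y powr - \<gamma>) has_integral (c - x) powr (1 - \<gamma>) / (\<gamma> - 1)) {c - x..}"
    using has_integral_powr_to_inf [of "- \<gamma>" "c - x"] assms by (simp add: minus_divide_right)
  then have "((\<lambda>y. (- x + 1 * y) powr - \<gamma>) has_integral (c - x) powr (1 - \<gamma>) / (\<gamma> - 1)) {y. - x + 1 * y \<in> {c - x..}}"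
    by (intro has_integral_isometry_nonneg) auto
  then have "((\<lambda>y. (- x + 1 * y) powr - \<gamma>) has_integral (c - x) powr (1 - \<gamma>) / (\<gamma> - 1)) {c<..}"
    by (subst (asm) has_integral_spike_set_eq [where T = "{c<..}"])
       (auto intro!: negligible_subset [OF negligible_sing [of c]])
  then show ?thesis
    by (rule has_integral_eq [rotated]) (use assms in \<open>auto simp: powr_minus divide_inverse\<close>)
qed

lemma has_integral_kernel_left_inf:
  fixes x c \<gamma> :: real
  assumes "c < x" "\<gamma> > 1"
  shows "((\<lambda>y. 1 / \<bar>x - y\<bar> powr \<gamma>) has_integral (x - c) powr (1 - \<gamma>) / (\<gamma> - 1)) {..<c}"
proof -
  have "{y. 2 * x + - 1 * y \<in> {2 * x - c<..}} = {..<c}"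
    by auto
  moreover have "2 * x + - 1 * y - x = x - y" for y
    by simp
  ultimately show ?thesis
    using has_integral_isometry_nonneg
      [OF has_integral_kernel_right_inf [of x "2 * x - c" \<gamma>], where c = "2 * x" and a = "- 1"] assms
    by (simp add: abs_minus_commute)
qed

subsection \<open>The energy of a union of two intervals\<close>

text \<open>The common form of both energies: exponent 1 + s between E and its complement, exponent
  \<alpha> between E and itself. Iterated integrals reduce everything to one-dimensional
  antiderivatives.\<close>

definition interaction :: "real \<Rightarrow> real set \<Rightarrow> real set \<Rightarrow> ennreal" where
  "interaction \<gamma> A B =
     (\<integral>\<^sup>+x\<in>A. (\<integral>\<^sup>+y\<in>B. ennreal (1 / \<bar>x - y\<bar> powr \<gamma>) \<partial>lborel) \<partial>lborel)"

lemma nn_integral_kernel_prod: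
  assumes [measurable]: "A \<in> sets borel" "B \<in> sets borel"
  shows "(\<integral>\<^sup>+p\<in>A \<times> B. ennreal (1 / \<bar>fst p - snd p\<bar> powr \<gamma>) \<partial>lebesgue) = interaction \<gamma> A B"
proof -
  let ?f = "\<lambda>p. ennreal (1 / \<bar>fst p - snd p\<bar> powr \<gamma>) * indicator (A \<times> B) p"
  have "(\<integral>\<^sup>+p. ?f p \<partial>lebesgue) = (\<integral>\<^sup>+p. ?f p \<partial>(lborel \<Otimes>\<^sub>M lborel))"
    by (simp add: nn_integral_completion lborel_prod)
  also have "\<dots> = (\<integral>\<^sup>+x. \<integral>\<^sup>+y. ?f (x, y) \<partial>lborel \<partial>lborel)"
    by (rule lborel.nn_integral_fst [symmetric]) measurable
  also have "\<dots> = interaction \<gamma> A B"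
    unfolding interaction_def
    by (intro nn_integral_cong) (auto simp: indicator_times nn_integral_multc split: split_indicator)
  finally show ?thesis .
qed

lemma interaction_sym:
  assumes [measurable]: "A \<in> sets borel" "B \<in> sets borel"
  shows "interaction \<gamma> A B = interaction \<gamma> B A"
proof -
  let ?f = "\<lambda>x y. ennreal (1 / \<bar>x - y\<bar> powr \<gamma>) * indicator A x * indicator B y"
  have "interaction \<gamma> A B = (\<integral>\<^sup>+x. \<integral>\<^sup>+y. ?f x y \<partial>lborel \<partial>lborel)"
    unfolding interaction_def by (intro nn_integral_cong) (auto split: split_indicator)
  also have "\<dots> = (\<integral>\<^sup>+y. \<integral>\<^sup>+x. ?f x y \<partial>lborel \<partial>lborel)"
    by (rule lborel_pair.Fubini' [symmetric]) measurable
  also have "\<dots> = interaction \<gamma> B A"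
    unfolding interaction_def
    by (intro nn_integral_cong) (auto simp: abs_minus_commute split: split_indicator)
  finally show ?thesis .
qed

lemma interaction_Un_left:
  assumes [measurable]: "A \<in> sets borel" "A' \<in> sets borel" "B \<in> sets borel" and "A \<inter> A' = {}"
  shows "interaction \<gamma> (A \<union> A') B = interaction \<gamma> A B + interaction \<gamma> A' B"
  unfolding interaction_def by (rule nn_integral_disjoint_pair) (use assms in auto)

lemma interaction_Un_right:
  assumes "A \<in> sets borel" "B \<in> sets borel" "B' \<in> sets borel" and "B \<inter> B' = {}"
  shows "interaction \<gamma> A (B \<union> B') = interaction \<gamma> A B + interaction \<gamma> A B'"
  using assms by (simp add: interaction_sym [of A] interaction_Un_left)

text \<open>Lets the complement of E lose its finitely many endpoints and become a union of open
  intervals.\<close>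

lemma interaction_cong_AE:
  assumes "AE y in lborel. y \<in> B \<longleftrightarrow> y \<in> B'"
  shows "interaction \<gamma> A B = interaction \<gamma> A B'"
proof -
  have "(\<integral>\<^sup>+y\<in>B. ennreal (1 / \<bar>x - y\<bar> powr \<gamma>) \<partial>lborel)
      = (\<integral>\<^sup>+y\<in>B'. ennreal (1 / \<bar>x - y\<bar> powr \<gamma>) \<partial>lborel)" for x
    by (rule nn_integral_cong_AE) (use assms in eventually_elim, auto split: split_indicator)
  then show ?thesis
    by (simp add: interaction_def)
qed

text \<open>The bound \<open>0 \<le> v\<close> is part of the conclusion because
  \<open>ennreal\<close> truncates negative numbers: sums of such values can be merged only when
  each summand is nonnegative.\<close>

lemma interaction_eqI:
  assumes inner: "\<And>x. x \<in> A \<Longrightarrow> ((\<lambda>y. 1 / \<bar>x - y\<bar> powr \<gamma>) has_integral g x) B"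
    and outer: "(g has_integral v) A"
  shows "interaction \<gamma> A B = ennreal v \<and> 0 \<le> v"
proof -
  have g: "0 \<le> g x" if "x \<in> A" for x
    using has_integral_nonneg [OF inner [OF that]] by simp
  have "interaction \<gamma> A B = (\<integral>\<^sup>+x\<in>A. ennreal (g x) \<partial>lborel)"
    unfolding interaction_def
    by (intro nn_integral_cong)
       (auto simp: nn_integral_has_integral_lebesgue' [OF _ inner] split: split_indicator)
  also have "\<dots> = ennreal v"
    by (rule nn_integral_has_integral_lebesgue' [OF g outer])
  finally show ?thesis
    using has_integral_nonneg [OF outer] g by auto
qed

text \<open>A second antiderivative of r^-\<gamma>. For 1 < \<gamma> < 2 it is negative for r > 0
  and tends to 0 at 0, although its derivative blows up there.\<close>

definition kernel_prim :: "real \<Rightarrow> real \<Rightarrow> real" where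
  "kernel_prim \<gamma> r = r powr (2 - \<gamma>) / ((1 - \<gamma>) * (2 - \<gamma>))"

lemma kernel_prim_0 [simp]: "kernel_prim \<gamma> 0 = 0"
  by (simp add: kernel_prim_def)

text \<open>r^(1-\<gamma>) is itself a power kernel, of exponent \<gamma> - 1 < 1, so the formula
  already proved applies a second time, even when the interval starts at x.\<close>

lemma has_integral_powr_right:
  assumes "x \<le> a" "a \<le> b" "\<gamma> < 2" "\<gamma> \<noteq> 1"
  shows "((\<lambda>y. (y - x) powr (1 - \<gamma>) / (1 - \<gamma>)) has_integral
           kernel_prim \<gamma> (b - x) - kernel_prim \<gamma> (a - x)) {a<..<b}"
proof -
  have 1: "((\<lambda>y. 1 / \<bar>x - y\<bar> powr (\<gamma> - 1) / (1 - \<gamma>)) has_integral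
      (((b - x) powr (2 - \<gamma>) - (a - x) powr (2 - \<gamma>)) / (2 - \<gamma>)) / (1 - \<gamma>)) {a<..<b}"
    using has_integral_divide [OF has_integral_kernel_right [of x a b "\<gamma> - 1"], of "1 - \<gamma>"] assms
    by simp
  have 2: "1 / \<bar>x - y\<bar> powr (\<gamma> - 1) / (1 - \<gamma>) = (y - x) powr (1 - \<gamma>) / (1 - \<gamma>)" if "y \<in> {a<..<b}" for y
    using that assms powr_minus_divide [of "y - x" "\<gamma> - 1"] by simp
  have 3: "(((b - x) powr (2 - \<gamma>) - (a - x) powr (2 - \<gamma>)) / (2 - \<gamma>)) / (1 - \<gamma>)
      = kernel_prim \<gamma> (b - x) - kernel_prim \<gamma> (a - x)"
    by (simp add: kernel_prim_def diff_divide_distrib mult.commute)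
  show ?thesis
    using 1 unfolding 3 by (subst (asm) has_integral_cong [OF 2])
qed

lemma has_integral_powr_left:
  assumes "b \<le> x" "a \<le> b" "\<gamma> < 2" "\<gamma> \<noteq> 1"
  shows "((\<lambda>y. (x - y) powr (1 - \<gamma>) / (1 - \<gamma>)) has_integral
           kernel_prim \<gamma> (x - a) - kernel_prim \<gamma> (x - b)) {a<..<b}"
proof -
  have 1: "((\<lambda>y. 1 / \<bar>x - y\<bar> powr (\<gamma> - 1) / (1 - \<gamma>)) has_integral
      (((x - a) powr (2 - \<gamma>) - (x - b) powr (2 - \<gamma>)) / (2 - \<gamma>)) / (1 - \<gamma>)) {a<..<b}"
    using has_integral_divide [OF has_integral_kernel_left [of b x a "\<gamma> - 1"], of "1 - \<gamma>"] assms
    by simp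
  have 2: "1 / \<bar>x - y\<bar> powr (\<gamma> - 1) / (1 - \<gamma>) = (x - y) powr (1 - \<gamma>) / (1 - \<gamma>)" if "y \<in> {a<..<b}" for y
    using that assms powr_minus_divide [of "x - y" "\<gamma> - 1"] by simp
  have 3: "(((x - a) powr (2 - \<gamma>) - (x - b) powr (2 - \<gamma>)) / (2 - \<gamma>)) / (1 - \<gamma>)
      = kernel_prim \<gamma> (x - a) - kernel_prim \<gamma> (x - b)"
    by (simp add: kernel_prim_def diff_divide_distrib mult.commute)
  show ?thesis
    using 1 unfolding 3 by (subst (asm) has_integral_cong [OF 2])
qed

text \<open>Integrating twice leaves a mixed second difference of the second antiderivative. Contact
  \<open>b = c\<close> is allowed, since \<gamma> < 2 keeps the outer integral finite; this is what
  makes the fractional perimeter of an interval finite.\<close>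

lemma interaction_intervals:
  assumes "a \<le> b" "b \<le> c" "c \<le> d" "\<gamma> < 2" "\<gamma> \<noteq> 1"
  defines "v \<equiv> kernel_prim \<gamma> (d - a) - kernel_prim \<gamma> (d - b) - kernel_prim \<gamma> (c - a) + kernel_prim \<gamma> (c - b)"
  shows "interaction \<gamma> {a<..<b} {c<..<d} = ennreal v \<and> 0 \<le> v"
proof (rule interaction_eqI)
  show "((\<lambda>y. 1 / \<bar>x - y\<bar> powr \<gamma>) has_integral
      (d - x) powr (1 - \<gamma>) / (1 - \<gamma>) - (c - x) powr (1 - \<gamma>) / (1 - \<gamma>)) {c<..<d}" if "x \<in> {a<..<b}" for x
    using has_integral_kernel_right [of x c d \<gamma>] that assms by (simp add: diff_divide_distrib)
  show "((\<lambda>x. (d - x) powr (1 - \<gamma>) / (1 - \<gamma>) - (c - x) powr (1 - \<gamma>) / (1 - \<gamma>)) has_integral v) {a<..<b}"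
    using has_integral_diff [OF has_integral_powr_left [of b d a \<gamma>] has_integral_powr_left [of b c a \<gamma>]] assms
    by (simp add: algebra_simps)
qed

text \<open>1 < \<gamma> gives convergence at infinity and \<gamma> < 2 convergence at a possible
  contact point.\<close>

lemma interaction_right_half_line:
  assumes "a \<le> b" "b \<le> c" "1 < \<gamma>" "\<gamma> < 2"
  defines "v \<equiv> kernel_prim \<gamma> (c - b) - kernel_prim \<gamma> (c - a)"
  shows "interaction \<gamma> {a<..<b} {c<..} = ennreal v \<and> 0 \<le> v"
proof (rule interaction_eqI)
  show "((\<lambda>y. 1 / \<bar>x - y\<bar> powr \<gamma>) has_integral - ((c - x) powr (1 - \<gamma>) / (1 - \<gamma>))) {c<..}"
    if "x \<in> {a<..<b}" for x
    using has_integral_kernel_right_inf [of x c \<gamma>] that assms by (simp add: minus_divide_right)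
  show "((\<lambda>x. - ((c - x) powr (1 - \<gamma>) / (1 - \<gamma>))) has_integral v) {a<..<b}"
    using has_integral_neg [OF has_integral_powr_left [of b c a \<gamma>]] assms by simp
qed

lemma interaction_left_half_line:
  assumes "a \<le> b" "c \<le> a" "1 < \<gamma>" "\<gamma> < 2"
  defines "v \<equiv> kernel_prim \<gamma> (a - c) - kernel_prim \<gamma> (b - c)"
  shows "interaction \<gamma> {a<..<b} {..<c} = ennreal v \<and> 0 \<le> v"
proof (rule interaction_eqI)
  show "((\<lambda>y. 1 / \<bar>x - y\<bar> powr \<gamma>) has_integral - ((x - c) powr (1 - \<gamma>) / (1 - \<gamma>))) {..<c}"
    if "x \<in> {a<..<b}" for x
    using has_integral_kernel_left_inf [of c x \<gamma>] that assms by (simp add: minus_divide_right)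
  show "((\<lambda>x. - ((x - c) powr (1 - \<gamma>) / (1 - \<gamma>))) has_integral v) {a<..<b}"
    using has_integral_neg [OF has_integral_powr_right [of c a b \<gamma>]] assms by simp
qed

text \<open>Splitting the inner integral at the diagonal \<open>y = x\<close> gives two one-sided
  kernels, whose contributions coincide by symmetry.\<close>

lemma interaction_self:
  assumes "a \<le> b" "\<gamma> < 1"
  shows "interaction \<gamma> {a<..<b} {a<..<b} = ennreal (2 * kernel_prim \<gamma> (b - a)) \<and> 0 \<le> 2 * kernel_prim \<gamma> (b - a)"
proof (rule interaction_eqI)
  show "((\<lambda>y. 1 / \<bar>x - y\<bar> powr \<gamma>) has_integral
      (x - a) powr (1 - \<gamma>) / (1 - \<gamma>) + (b - x) powr (1 - \<gamma>) / (1 - \<gamma>)) {a<..<b}" if "x \<in> {a<..<b}" for x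
    using has_integral_kernel_left [of x x a \<gamma>] has_integral_kernel_right [of x x b \<gamma>] that assms
    unfolding has_integral_Icc_iff_Ioo [symmetric]
    by (intro has_integral_combine [where c = x]) auto
  show "((\<lambda>x. (x - a) powr (1 - \<gamma>) / (1 - \<gamma>) + (b - x) powr (1 - \<gamma>) / (1 - \<gamma>)) has_integral
      2 * kernel_prim \<gamma> (b - a)) {a<..<b}"
    using has_integral_add [OF has_integral_powr_right [of a a b \<gamma>] has_integral_powr_left [of b b a \<gamma>]] assms
    by simp
qed

text \<open>Both energies are the same signed sum over the six distances between endpoints, plus for
  a left and a right endpoint, minus for two of the same kind. The perimeter enters with the
  opposite sign because it pairs E with its complement instead of with itself.\<close>

definition energy_prim :: "real \<Rightarrow> real \<Rightarrow> real \<Rightarrow> real" where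
  "energy_prim s \<alpha> r = 2 * kernel_prim \<alpha> r - 2 * kernel_prim (1 + s) r"

lemma frac_perimeter_two_intervals:
  assumes "p < q" "q < p'" "p' < q'" "0 < s" "s < 1"
  defines "g \<equiv> kernel_prim (1 + s)"
  defines "v \<equiv> - 2 * (g (q - p) + g (q' - p') + g (q' - p) - g (q' - q) - g (p' - p) + g (p' - q))"
  shows "frac_perimeter s ({p<..<q} \<union> {p'<..<q'}) = ennreal v \<and> 0 \<le> v"
proof -
  let ?I = "{p<..<q}" and ?J = "{p'<..<q'}" and ?G = "{q<..<p'}"
  let ?C = "{..<p} \<union> ({q<..<p'} \<union> {q'<..})"
  \<comment> \<open>Up to the four endpoints the complement consists of two half-lines and the
    gap.\<close>
  have "AE y in lborel. y \<noteq> p \<and> y \<noteq> q \<and> y \<noteq> p' \<and> y \<noteq> q'"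
    by (intro AE_conjI AE_lborel_singleton)
  then have "AE y in lborel. y \<in> - (?I \<union> ?J) \<longleftrightarrow> y \<in> ?C"
    by eventually_elim (use assms in auto)
  then have 1: "frac_perimeter s (?I \<union> ?J) = interaction (1 + s) (?I \<union> ?J) ?C"
    unfolding frac_perimeter_def by (subst nn_integral_kernel_prod) (auto intro: interaction_cong_AE)
  have dis: "?I \<inter> ?J = {}" "{..<p} \<inter> (?G \<union> {q'<..}) = {}" "?G \<inter> {q'<..} = {}"
    using assms by auto
  note 1
  \<comment> \<open>In the last group the gap is put before \<open>?J\<close>, because the formula
    for two intervals expects the left one first.\<close>
  also have "interaction (1 + s) (?I \<union> ?J) ?C = (interaction (1 + s) ?I {..<p} + (interaction (1 + s) ?I ?G + interaction (1 + s) ?I {q'<..}))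
      + (interaction (1 + s) ?J {..<p} + (interaction (1 + s) ?G ?J + interaction (1 + s) ?J {q'<..}))"
    by (simp add: interaction_Un_left [OF _ _ _ dis(1)] interaction_Un_right [OF _ _ _ dis(2)]
        interaction_Un_right [OF _ _ _ dis(3)] interaction_sym [of ?J ?G])
  finally have *: "frac_perimeter s (?I \<union> ?J) = \<dots>" .
  have "interaction (1 + s) ?I {..<p} = ennreal (- g (q - p)) \<and> 0 \<le> - g (q - p)"
    using interaction_left_half_line [of p q p "1 + s"] assms by simp
  moreover have "interaction (1 + s) ?I ?G = ennreal (g (p' - p) - g (p' - q) - g (q - p))
      \<and> 0 \<le> g (p' - p) - g (p' - q) - g (q - p)"
    using interaction_intervals [of p q q p' "1 + s"] assms by simp
  moreover have "interaction (1 + s) ?I {q'<..} = ennreal (g (q' - q) - g (q' - p)) \<and> 0 \<le> g (q' - q) - g (q' - p)"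
    using interaction_right_half_line [of p q q' "1 + s"] assms by simp
  moreover have "interaction (1 + s) ?J {..<p} = ennreal (g (p' - p) - g (q' - p)) \<and> 0 \<le> g (p' - p) - g (q' - p)"
    using interaction_left_half_line [of p' q' p "1 + s"] assms by simp
  moreover have "interaction (1 + s) ?G ?J = ennreal (g (q' - q) - g (q' - p') - g (p' - q))
      \<and> 0 \<le> g (q' - q) - g (q' - p') - g (p' - q)"
    using interaction_intervals [of q p' p' q' "1 + s"] assms by simp
  moreover have "interaction (1 + s) ?J {q'<..} = ennreal (- g (q' - p')) \<and> 0 \<le> - g (q' - p')"
    using interaction_right_half_line [of p' q' q' "1 + s"] assms by simp
  ultimately show ?thesis
    unfolding * v_def by (simp flip: ennreal_plus add: algebra_simps)
qed

lemma riesz_energy_two_intervals: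
  assumes "p < q" "q < p'" "p' < q'" "0 < \<alpha>" "\<alpha> < 1"
  defines "g \<equiv> kernel_prim \<alpha>"
  defines "v \<equiv> 2 * (g (q - p) + g (q' - p') + g (q' - p) - g (q' - q) - g (p' - p) + g (p' - q))"
  shows "riesz_energy \<alpha> ({p<..<q} \<union> {p'<..<q'}) = ennreal v \<and> 0 \<le> v"
proof -
  let ?I = "{p<..<q}" and ?J = "{p'<..<q'}"
  have 1: "riesz_energy \<alpha> (?I \<union> ?J) = interaction \<alpha> (?I \<union> ?J) (?I \<union> ?J)"
    unfolding riesz_energy_def by (rule nn_integral_kernel_prod) auto
  have dis: "?I \<inter> ?J = {}"
    using assms by auto
  note 1
  also have "interaction \<alpha> (?I \<union> ?J) (?I \<union> ?J) = (interaction \<alpha> ?I ?I + interaction \<alpha> ?I ?J) + (interaction \<alpha> ?I ?J + interaction \<alpha> ?J ?J)"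
    by (simp add: interaction_Un_left [OF _ _ _ dis] interaction_Un_right [OF _ _ _ dis] interaction_sym [of ?J ?I])
  finally have *: "riesz_energy \<alpha> (?I \<union> ?J) = \<dots>" .
  have "interaction \<alpha> ?I ?I = ennreal (2 * g (q - p)) \<and> 0 \<le> 2 * g (q - p)"
    and "interaction \<alpha> ?J ?J = ennreal (2 * g (q' - p')) \<and> 0 \<le> 2 * g (q' - p')"
    using interaction_self [of p q \<alpha>] interaction_self [of p' q' \<alpha>] assms by auto
  moreover have "interaction \<alpha> ?I ?J = ennreal (g (q' - p) - g (q' - q) - g (p' - p) + g (p' - q))
      \<and> 0 \<le> g (q' - p) - g (q' - q) - g (p' - p) + g (p' - q)"
    using interaction_intervals [of p q p' q' \<alpha>] assms by simp
  ultimately show ?thesis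
    unfolding * v_def by (simp flip: ennreal_plus add: algebra_simps)
qed

lemma energy_two_intervals:
  assumes "p < q" "q < p'" "p' < q'" "0 < s" "s < 1" "0 < \<alpha>" "\<alpha> < 1"
  defines "k \<equiv> energy_prim s \<alpha>"
  defines "v \<equiv> k (q - p) + k (q' - p') + k (q' - p) - k (q' - q) - k (p' - p) + k (p' - q)"
  shows "energy s \<alpha> ({p<..<q} \<union> {p'<..<q'}) = ennreal v \<and> 0 \<le> v"
  using frac_perimeter_two_intervals [OF assms(1-5)] riesz_energy_two_intervals [OF assms(1-3,6-7)]
  unfolding energy_def v_def k_def energy_prim_def
  by (simp flip: ennreal_plus add: algebra_simps)

subsection \<open>Flows on the line and criticality\<close>

text \<open>The derivative is continuous on the compact support and zero off it, hence bounded. The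
  global constant is what uniqueness of trajectories rests on.\<close>

lemma test_field_lipschitz:
  assumes "test_field X"
  obtains K where "\<And>x y. \<bar>X x - X y\<bar> \<le> K * \<bar>x - y\<bar>"
proof -
  let ?S = "closure {x. X x \<noteq> 0}"
  have "(deriv ^^ 0) X differentiable (at x)" "(deriv ^^ 1) X differentiable (at x)" for x
    using assms unfolding test_field_def by blast+
  then have diff: "(X has_real_derivative deriv X x) (at x)" and "isCont (deriv X) x" for x
    by (auto simp: DERIV_deriv_iff_real_differentiable intro: differentiable_imp_continuous_within)
  then have "continuous_on ?S (deriv X)"
    by (simp add: continuous_at_imp_continuous_on)
  moreover have "compact ?S"
    using assms by (simp add: test_field_def)
  ultimately have "bounded (deriv X ` ?S)"
    by (intro compact_imp_bounded compact_continuous_image)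
  then obtain K where K: "0 < K" "\<And>x. x \<in> ?S \<Longrightarrow> \<bar>deriv X x\<bar> \<le> K"
    unfolding bounded_pos by auto
  have "deriv X x = 0" if "x \<notin> ?S" for x
  proof (rule DERIV_imp_deriv)
    show "(X has_real_derivative 0) (at x)"
    proof (rule has_field_derivative_transform_within_open)
      show "((\<lambda>_. 0) has_real_derivative 0) (at x)" "open (- ?S)" "x \<in> - ?S"
        using that by auto
      show "0 = X y" if "y \<in> - ?S" for y
        using that closure_subset [of "{x. X x \<noteq> 0}"] by auto
    qed
  qed
  then have "\<bar>deriv X x\<bar> \<le> K" for x
    using K by (cases "x \<in> ?S") auto
  then have "\<bar>X x - X y\<bar> \<le> K * \<bar>x - y\<bar>" for x y
    using field_differentiable_bound [of UNIV X "deriv X" K] diff by simp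
  then show thesis
    by (rule that)
qed

text \<open>Gronwall's argument: the squared distance of two solutions, damped by exp(-2 K t),
  cannot increase, and it starts at 0.\<close>

lemma ode_unique_forward:
  fixes u v X :: "real \<Rightarrow> real"
  assumes lip: "\<And>x y. \<bar>X x - X y\<bar> \<le> K * \<bar>x - y\<bar>"
    and u: "\<And>t. (u has_real_derivative X (u t)) (at t)"
    and v: "\<And>t. (v has_real_derivative X (v t)) (at t)"
    and eq: "u a = v a" and "a \<le> t"
  shows "u t = v t"
proof -
  let ?w = "\<lambda>t. (u t - v t)\<^sup>2 * exp (- 2 * K * t)"
  have "?w t \<le> ?w a"
  proof (rule DERIV_nonpos_imp_nonincreasing [OF \<open>a \<le> t\<close>])
    fix r
    let ?d = "u r - v r"
    let ?w' = "2 * exp (- 2 * K * r) * (?d * (X (u r) - X (v r)) - K * ?d\<^sup>2)"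
    have "(?w has_real_derivative ?w') (at r)"
      by (auto intro!: derivative_eq_intros u v simp: algebra_simps power2_eq_square)
    moreover have "?d * (X (u r) - X (v r)) \<le> \<bar>?d\<bar> * \<bar>X (u r) - X (v r)\<bar>"
      by (simp flip: abs_mult)
    then have "?d * (X (u r) - X (v r)) \<le> \<bar>?d\<bar> * (K * \<bar>?d\<bar>)"
      by (meson lip abs_ge_zero mult_left_mono order_trans)
    then have "?w' \<le> 0"
      by (intro mult_nonneg_nonpos) (auto simp: power2_eq_square algebra_simps)
    ultimately show "\<exists>y. (?w has_real_derivative y) (at r) \<and> y \<le> 0"
      by blast
  qed
  then have "(u t - v t)\<^sup>2 \<le> 0"
    using eq by (simp add: mult_le_0_iff not_le)
  then show ?thesis
    by simp
qed

lemma ode_unique: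
  fixes u v X :: "real \<Rightarrow> real"
  assumes lip: "\<And>x y. \<bar>X x - X y\<bar> \<le> K * \<bar>x - y\<bar>"
    and u: "\<And>t. (u has_real_derivative X (u t)) (at t)"
    and v: "\<And>t. (v has_real_derivative X (v t)) (at t)"
    and eq: "u a = v a"
  shows "u t = v t"
proof (cases "a \<le> t")
  case True
  show ?thesis
    by (rule ode_unique_forward [OF lip u v eq True])
next
  case False
  \<comment> \<open>Reversing time turns solutions for \<open>X\<close> into solutions for
    \<open>- X\<close>, which has the same Lipschitz constant.\<close>
  have rev: "((\<lambda>t. w (- t)) has_real_derivative - X (w (- t))) (at t)"
    if "\<And>t. (w has_real_derivative X (w t)) (at t)" for w :: "real \<Rightarrow> real" and t
    using DERIV_chain2 [OF that DERIV_minus [OF DERIV_ident]] by simp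
  have lip': "\<bar>- X x - - X y\<bar> \<le> K * \<bar>x - y\<bar>" for x y
    using lip [of x y] by simp
  have "u (- (- t)) = v (- (- t))"
    by (rule ode_unique_forward [OF lip' rev [OF u] rev [OF v], where a = "- a"]) (use eq False in auto)
  then show ?thesis
    by simp
qed

text \<open>If two trajectories changed order, they would meet at some time by continuity, and
  uniqueness would then identify their starting points.\<close>

lemma flow_strict_mono:
  assumes X: "test_field X" and flow: "is_flow X \<Phi>" and "x < y"
  shows "\<Phi> t x < \<Phi> t y"
proof (rule ccontr)
  obtain K where lip: "\<And>x y. \<bar>X x - X y\<bar> \<le> K * \<bar>x - y\<bar>"
    using test_field_lipschitz [OF X] by blast
  have der: "((\<lambda>\<tau>. \<Phi> \<tau> z) has_real_derivative X (\<Phi> r z)) (at r)" and init: "\<Phi> 0 z = z" for r z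
    using flow by (auto simp: is_flow_def)
  let ?R = "range (\<lambda>\<tau>. \<Phi> \<tau> y - \<Phi> \<tau> x)"
  assume "\<not> ?thesis"
  then have "\<Phi> t y - \<Phi> t x \<le> 0"
    by simp
  moreover have "0 \<le> \<Phi> 0 y - \<Phi> 0 x"
    using \<open>x < y\<close> init by simp
  moreover have "connected ?R"
    by (intro connected_continuous_image connected_UNIV continuous_intros DERIV_continuous_on)
      (rule der [THEN has_field_derivative_at_within])+
  ultimately have "0 \<in> ?R"
    using connected_contains_Icc [of ?R "\<Phi> t y - \<Phi> t x" "\<Phi> 0 y - \<Phi> 0 x"] by auto
  then obtain a where "\<Phi> a x = \<Phi> a y"
    by (metis (no_types, lifting) eq_iff_diff_eq_0 imageE)
  then have "\<Phi> 0 x = \<Phi> 0 y"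
    by (rule ode_unique [OF lip der der])
  with init \<open>x < y\<close> show False
    by simp
qed

lemma flow_add:
  assumes X: "test_field X" and flow: "is_flow X \<Phi>"
  shows "\<Phi> (t + r) x = \<Phi> t (\<Phi> r x)"
proof -
  obtain K where lip: "\<And>x y. \<bar>X x - X y\<bar> \<le> K * \<bar>x - y\<bar>"
    using test_field_lipschitz [OF X] by blast
  have der: "((\<lambda>\<tau>. \<Phi> \<tau> z) has_real_derivative X (\<Phi> r z)) (at r)" and init: "\<Phi> 0 z = z" for r z
    using flow by (auto simp: is_flow_def)
  have "((\<lambda>\<tau>. \<Phi> (\<tau> + r) x) has_real_derivative X (\<Phi> (\<tau> + r) x)) (at \<tau>)" for \<tau>
    using der DERIV_shift [of "\<lambda>\<tau>. \<Phi> \<tau> x"] by blast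
  then show ?thesis
    by (rule ode_unique [OF lip _ der, where a = 0]) (simp add: init)
qed

text \<open>The group law makes \<Phi> at time -t the inverse of \<Phi> at time t, and monotonicity
  of this inverse gives surjectivity onto the image interval.\<close>

lemma flow_image_interval:
  assumes X: "test_field X" and flow: "is_flow X \<Phi>"
  shows "\<Phi> t ` {a<..<b} = {\<Phi> t a<..<\<Phi> t b}"
proof
  show "\<Phi> t ` {a<..<b} \<subseteq> {\<Phi> t a<..<\<Phi> t b}"
    using flow_strict_mono [OF X flow] by auto
next
  have inv: "\<Phi> (- t) (\<Phi> t z) = z" "\<Phi> t (\<Phi> (- t) z) = z" for z
    using flow_add [OF X flow, of "- t" t z] flow_add [OF X flow, of t "- t" z] flow
    by (auto simp: is_flow_def)
  show "{\<Phi> t a<..<\<Phi> t b} \<subseteq> \<Phi> t ` {a<..<b}"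
  proof
    fix z
    assume "z \<in> {\<Phi> t a<..<\<Phi> t b}"
    then have "\<Phi> (- t) z \<in> {a<..<b}"
      using flow_strict_mono [OF X flow, of _ _ "- t"] inv by force
    then show "z \<in> \<Phi> t ` {a<..<b}"
      using inv(2) [of z] by force
  qed
qed

text \<open>The integral of t^-(1+s) over t > r plus \<epsilon> times the integral of t^-\<alpha>
  over 0 < t < r; for \<epsilon> = 1 it is half the derivative of
  \<open>energy_prim\<close>.\<close>

definition endpoint_force :: "real \<Rightarrow> real \<Rightarrow> real \<Rightarrow> real \<Rightarrow> real" where
  "endpoint_force s \<alpha> \<epsilon> r = r powr - s / s + \<epsilon> * (r powr (1 - \<alpha>) / (1 - \<alpha>))"

lemma DERIV_kernel_prim:
  assumes "0 < r" "\<gamma> \<noteq> 1" "\<gamma> \<noteq> 2"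
  shows "(kernel_prim \<gamma> has_real_derivative r powr (1 - \<gamma>) / (1 - \<gamma>)) (at r)"
proof -
  have "((\<lambda>r. r powr (2 - \<gamma>) / ((1 - \<gamma>) * (2 - \<gamma>))) has_real_derivative
      (2 - \<gamma>) * r powr (2 - \<gamma> - 1) / ((1 - \<gamma>) * (2 - \<gamma>))) (at r)"
    by (intro DERIV_cdivide has_real_derivative_powr assms)
  then show ?thesis
    using assms by (simp add: kernel_prim_def [abs_def])
qed

lemma DERIV_energy_prim:
  assumes "0 < r" "0 < s" "s < 1" "0 < \<alpha>" "\<alpha> < 1"
  shows "(energy_prim s \<alpha> has_real_derivative 2 * endpoint_force s \<alpha> 1 r) (at r)"
proof -
  have "((\<lambda>r. 2 * kernel_prim \<alpha> r - 2 * kernel_prim (1 + s) r) has_real_derivative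
      2 * (r powr (1 - \<alpha>) / (1 - \<alpha>)) - 2 * (r powr (1 - (1 + s)) / (1 - (1 + s)))) (at r)"
    by (intro DERIV_diff DERIV_cmult DERIV_kernel_prim) (use assms in auto)
  then show ?thesis
    by (simp add: energy_prim_def [abs_def] endpoint_force_def algebra_simps)
qed

section \<open>The symmetric configuration and its first variation\<close>

definition twin_intervals :: "real \<Rightarrow> real \<Rightarrow> real set" where
  "twin_intervals A L = {- A / 2 - L<..<- A / 2} \<union> {A / 2<..<A / 2 + L}"

lemma emeasure_two_intervals:
  fixes p q p' q' :: real
  assumes "p \<le> q" "q \<le> p'" "p' \<le> q'"
  shows "emeasure lebesgue ({p<..<q} \<union> {p'<..<q'}) = ennreal ((q - p) + (q' - p'))"
  using assms by (subst plus_emeasure [symmetric]) (auto simp flip: ennreal_plus)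

lemma emeasure_twin_intervals:
  assumes "0 < A" "0 < L"
  shows "emeasure lebesgue (twin_intervals A L) = ennreal (2 * L)"
  using emeasure_two_intervals [of "- A / 2 - L" "- A / 2" "A / 2" "A / 2 + L"] assms
  by (simp add: twin_intervals_def)

text \<open>A Lagrange multiplier argument in the four endpoints. Here \<epsilon> = 1, since F
  weights the Riesz term by 1.\<close>

lemma twin_intervals_critical:
  assumes "0 < A" "0 < L" "0 < s" "s < 1" "0 < \<alpha>" "\<alpha> < 1"
    and balance: "endpoint_force s \<alpha> 1 A + endpoint_force s \<alpha> 1 (A + 2 * L) = 2 * endpoint_force s \<alpha> 1 (A + L)"
  shows "volume_constrained_critical s \<alpha> (twin_intervals A L)"
  unfolding volume_constrained_critical_def
proof (intro conjI allI impI)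
  show "twin_intervals A L \<in> sets lebesgue"
    by (simp add: twin_intervals_def)
next
  fix X \<Phi>
  assume X: "test_field X" and flow: "is_flow X \<Phi>"
    and vol: "\<forall>\<^sub>F t in nhds 0. emeasure lebesgue (\<Phi> t ` twin_intervals A L) = emeasure lebesgue (twin_intervals A L)"
  define p q p' q' where "p = (\<lambda>t. \<Phi> t (- A / 2 - L))" and "q = (\<lambda>t. \<Phi> t (- A / 2))"
    and "p' = (\<lambda>t. \<Phi> t (A / 2))" and "q' = (\<lambda>t. \<Phi> t (A / 2 + L))"
  note endpoint_defs = p_def q_def p'_def q'_def
  have order: "p t < q t" "q t < p' t" "p' t < q' t" for t
    using assms by (auto simp: endpoint_defs intro!: flow_strict_mono [OF X flow])
  have im: "\<Phi> t ` twin_intervals A L = {p t<..<q t} \<union> {p' t<..<q' t}" for t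
    by (simp add: twin_intervals_def image_Un flow_image_interval [OF X flow] endpoint_defs)
  have init: "p 0 = - A / 2 - L" "q 0 = - A / 2" "p' 0 = A / 2" "q' 0 = A / 2 + L"
    using flow by (simp_all add: is_flow_def endpoint_defs)
  have der: "(p has_real_derivative X (p 0)) (at 0)" "(q has_real_derivative X (q 0)) (at 0)"
    "(p' has_real_derivative X (p' 0)) (at 0)" "(q' has_real_derivative X (q' 0)) (at 0)"
    using flow unfolding is_flow_def endpoint_defs by blast+
  \<comment> \<open>Differentiating the constant volume gives one linear relation between the
    endpoint velocities.\<close>
  let ?V = "\<lambda>t. (q t - p t) + (q' t - p' t)"
  have "(?V has_real_derivative (X (q 0) - X (p 0)) + (X (q' 0) - X (p' 0))) (at 0)"
    by (intro DERIV_add DERIV_diff der)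
  moreover have "\<forall>\<^sub>F t in nhds 0. ?V t = 2 * L"
    using vol
  proof eventually_elim
    case (elim t)
    moreover have "emeasure lebesgue (\<Phi> t ` twin_intervals A L) = ennreal (?V t)"
      unfolding im by (rule emeasure_two_intervals) (use order [of t] in auto)
    ultimately have "ennreal (?V t) = ennreal (2 * L)"
      using emeasure_twin_intervals [OF assms(1,2)] by simp
    then show ?case
      using order [of t] assms by (subst (asm) ennreal_inj) auto
  qed
  then have "(?V has_real_derivative 0) (at 0)"
    by (subst DERIV_cong_ev [OF refl _ refl, where g = "\<lambda>_. 2 * L"]) auto
  ultimately have flux: "(X (q 0) - X (p 0)) + (X (q' 0) - X (p' 0)) = 0"
    by (rule DERIV_unique)
  define k where "k = energy_prim s \<alpha>"
  let ?f = "endpoint_force s \<alpha> 1"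
  let ?F = "\<lambda>t. k (q t - p t) + k (q' t - p' t) + k (q' t - p t) - k (q' t - q t) - k (p' t - p t) + k (p' t - q t)"
  have en: "energy s \<alpha> (\<Phi> t ` twin_intervals A L) = ennreal (?F t) \<and> 0 \<le> ?F t" for t
    unfolding im k_def by (rule energy_two_intervals) (use order [of t] assms in auto)
  show "\<forall>\<^sub>F t in nhds 0. energy s \<alpha> (\<Phi> t ` twin_intervals A L) < \<infinity>"
    using en by simp
  have k': "((\<lambda>t. k (v t - u t)) has_real_derivative 2 * ?f (v 0 - u 0) * (X (v 0) - X (u 0))) (at 0)"
    if "u 0 < v 0" "(u has_real_derivative X (u 0)) (at 0)" "(v has_real_derivative X (v 0)) (at 0)" for u v
    unfolding k_def by (intro DERIV_chain2 [OF DERIV_energy_prim] DERIV_diff that) (use that assms in auto)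
  have "(?F has_real_derivative
      2 * ?f (q 0 - p 0) * (X (q 0) - X (p 0)) + 2 * ?f (q' 0 - p' 0) * (X (q' 0) - X (p' 0))
      + 2 * ?f (q' 0 - p 0) * (X (q' 0) - X (p 0)) - 2 * ?f (q' 0 - q 0) * (X (q' 0) - X (q 0))
      - 2 * ?f (p' 0 - p 0) * (X (p' 0) - X (p 0)) + 2 * ?f (p' 0 - q 0) * (X (p' 0) - X (q 0))) (at 0)"
    (is "(_ has_real_derivative ?D) _")
    by (intro DERIV_add DERIV_diff k' der order less_trans [OF order(1) order(2)]
        less_trans [OF order(2) order(3)] less_trans [OF order(1) less_trans [OF order(2) order(3)]])
  moreover have "?D = 0"
  proof -
    have gaps: "q 0 - p 0 = L" "q' 0 - p' 0 = L" "q' 0 - p 0 = A + 2 * L" "q' 0 - q 0 = A + L"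
      "p' 0 - p 0 = A + L" "p' 0 - q 0 = A"
      by (simp_all add: init)
    \<comment> \<open>Once balance eliminates \<open>?f (A + 2 * L)\<close>, all four velocities
      carry the same coefficient up to the signs of the volume derivative. The common factor is the
      multiplier.\<close>
    have "?D = 2 * (?f L + ?f (A + L) - ?f A) * ((X (q 0) - X (p 0)) + (X (q' 0) - X (p' 0)))"
      unfolding gaps eq_diff_eq [THEN iffD2, OF balance [unfolded add.commute [of "?f A"]]]
      by (simp add: algebra_simps)
    then show ?thesis
      by (simp add: flux)
  qed
  ultimately have "(?F has_real_derivative 0) (at 0)"
    by simp
  then show "((\<lambda>t. enn2real (energy s \<alpha> (\<Phi> t ` twin_intervals A L))) has_real_derivative 0) (at 0)"
    using en by simp
qed

subsection \<open>The Euler--Lagrange equation\<close>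

lemma set_lebesgue_integral_nonneg:
  fixes f :: "real \<Rightarrow> real"
  assumes "(f has_integral I) S" "\<And>y. y \<in> S \<Longrightarrow> 0 \<le> f y"
  shows "set_integrable lebesgue S f" "(LINT y:S|lebesgue. f y) = I"
proof -
  show 1: "set_integrable lebesgue S f"
    using assms by (intro nonnegative_absolutely_integrable_1) auto
  show "(LINT y:S|lebesgue. f y) = I"
    using set_lebesgue_integral_eq_integral(2) [OF 1] assms(1) by (simp add: integral_unique)
qed

text \<open>\<open>I\<close> is the component touching x, \<open>J\<close> the other one. The
  complement minus E equals the whole line minus twice E; the line contributes twice \<delta>^-s / s
  outside the \<delta>-ball and \<open>I\<close> contributes it once. The divergent terms cancel
  exactly, so the truncated integrals are constant for small \<delta>.\<close>

lemma has_frac_curvature_Un: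
  fixes x s :: real
  assumes "0 < s" "I \<inter> J = {}"
  defines "k \<equiv> \<lambda>y. 1 / \<bar>x - y\<bar> powr (1 + s)" and "T \<equiv> \<lambda>\<delta>. {y. \<delta> < \<bar>x - y\<bar>}"
  assumes I: "\<forall>\<^sub>F \<delta> in at_right 0. (k has_integral (\<delta> powr - s / s - N)) (I \<inter> T \<delta>)"
    and J: "\<forall>\<^sub>F \<delta> in at_right 0. (k has_integral N') (J \<inter> T \<delta>)"
  shows "has_frac_curvature s (I \<union> J) x (2 * (N - N'))"
  unfolding has_frac_curvature_def
proof (rule tendsto_eventually)
  show "\<forall>\<^sub>F \<delta> in at_right 0. (LINT y:{y. \<delta> < \<bar>x - y\<bar>}|lebesgue.
      (indicator (- (I \<union> J)) y - indicator (I \<union> J) y) / \<bar>x - y\<bar> powr (1 + s)) = 2 * (N - N')"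
    using I J eventually_at_right_less
  proof eventually_elim
    case (elim \<delta>)
    let ?E = "I \<union> J"
    have "{..<x - \<delta>} \<inter> {x + \<delta><..} = {}"
      using elim(3) by auto
    then have "(k has_integral (\<delta> powr - s / s + \<delta> powr - s / s)) ({..<x - \<delta>} \<union> {x + \<delta><..})"
      using has_integral_kernel_left_inf [of "x - \<delta>" x "1 + s"]
        has_integral_kernel_right_inf [of x "x + \<delta>" "1 + s"] elim(3) \<open>0 < s\<close>
      unfolding k_def by (intro has_integral_Un) auto
    moreover have "{..<x - \<delta>} \<union> {x + \<delta><..} = T \<delta>"
      using elim(3) by (auto simp: T_def)
    ultimately have T: "(k has_integral (\<delta> powr - s / s + \<delta> powr - s / s)) (T \<delta>)"
      by simp
    have "I \<inter> T \<delta> \<inter> (J \<inter> T \<delta>) = {}" "(I \<inter> T \<delta>) \<union> (J \<inter> T \<delta>) = ?E \<inter> T \<delta>"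
      using assms(2) by auto
    then have E: "(k has_integral (\<delta> powr - s / s - N + N')) (?E \<inter> T \<delta>)"
      using has_integral_Un [OF elim(1,2)] by simp
    have nonneg: "0 \<le> k y" for y
      by (simp add: k_def)
    let ?k' = "\<lambda>y. indicator ?E y * k y"
    have eq: "indicator (T \<delta>) y *\<^sub>R ?k' y = indicator (?E \<inter> T \<delta>) y *\<^sub>R k y" for y
      by (simp split: split_indicator)
    have E': "set_integrable lebesgue (T \<delta>) ?k'" "(LINT y:T \<delta>|lebesgue. ?k' y) = \<delta> powr - s / s - N + N'"
      using set_lebesgue_integral_nonneg [OF E nonneg]
      unfolding set_integrable_def set_lebesgue_integral_def eq by auto
    \<comment> \<open>The difference of the indicators is 1 - 2 \<open>indicator ?E\<close>.\<close>
    have "(LINT y:T \<delta>|lebesgue. (indicator (- ?E) y - indicator ?E y) / \<bar>x - y\<bar> powr (1 + s))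
        = (LINT y:T \<delta>|lebesgue. k y - 2 * ?k' y)"
      unfolding set_lebesgue_integral_def k_def
      by (intro Bochner_Integration.integral_cong) (auto split: split_indicator)
    also have "\<dots> = (LINT y:T \<delta>|lebesgue. k y) - 2 * (LINT y:T \<delta>|lebesgue. ?k' y)"
      using set_lebesgue_integral_nonneg [OF T nonneg] E' by (subst set_integral_diff) auto
    also have "\<dots> = 2 * (N - N')"
      using set_lebesgue_integral_nonneg [OF T nonneg] E' by simp
    finally show ?case
      by (simp add: T_def)
  qed
qed

context
  fixes x c d s :: real
  assumes s: "0 < s" and cd: "c < d"
begin

text \<open>An interval ending at x loses only the part within \<delta> of x, which leaves the
  divergent term \<delta>^-s / s.\<close>

lemma truncated_kernel_adjacent_right:
  "c = x \<Longrightarrow> \<forall>\<^sub>F \<delta> in at_right 0. ((\<lambda>y. 1 / \<bar>x - y\<bar> powr (1 + s)) has_integral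
     (\<delta> powr - s / s - (d - c) powr - s / s)) ({c<..<d} \<inter> {y. \<delta> < \<bar>x - y\<bar>})"
  unfolding eventually_at_right_field
proof (intro exI conjI allI impI)
  fix \<delta>
  assume "c = x" "0 < \<delta>" "\<delta> < d - x"
  then have "{c<..<d} \<inter> {y. \<delta> < \<bar>x - y\<bar>} = {x + \<delta><..<d}"
    by auto
  then show "((\<lambda>y. 1 / \<bar>x - y\<bar> powr (1 + s)) has_integral
     (\<delta> powr - s / s - (d - c) powr - s / s)) ({c<..<d} \<inter> {y. \<delta> < \<bar>x - y\<bar>})"
    using has_integral_kernel_right [of x "x + \<delta>" d "1 + s"] s \<open>c = x\<close> \<open>0 < \<delta>\<close> \<open>\<delta> < d - x\<close>
    by (simp add: diff_divide_distrib)
qed (use cd in simp)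

lemma truncated_kernel_adjacent_left:
  "d = x \<Longrightarrow> \<forall>\<^sub>F \<delta> in at_right 0. ((\<lambda>y. 1 / \<bar>x - y\<bar> powr (1 + s)) has_integral
     (\<delta> powr - s / s - (d - c) powr - s / s)) ({c<..<d} \<inter> {y. \<delta> < \<bar>x - y\<bar>})"
  unfolding eventually_at_right_field
proof (intro exI conjI allI impI)
  fix \<delta>
  assume "d = x" "0 < \<delta>" "\<delta> < x - c"
  then have "{c<..<d} \<inter> {y. \<delta> < \<bar>x - y\<bar>} = {c<..<x - \<delta>}"
    by auto
  then show "((\<lambda>y. 1 / \<bar>x - y\<bar> powr (1 + s)) has_integral
     (\<delta> powr - s / s - (d - c) powr - s / s)) ({c<..<d} \<inter> {y. \<delta> < \<bar>x - y\<bar>})"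
    using has_integral_kernel_left [of "x - \<delta>" x c "1 + s"] s \<open>d = x\<close> \<open>0 < \<delta>\<close> \<open>\<delta> < x - c\<close>
    by (simp add: diff_divide_distrib)
qed (use cd in simp)

text \<open>Once \<delta> is below the distance from x to the interval, truncation removes
  nothing.\<close>

lemma truncated_kernel_right:
  "x < c \<Longrightarrow> \<forall>\<^sub>F \<delta> in at_right 0. ((\<lambda>y. 1 / \<bar>x - y\<bar> powr (1 + s)) has_integral
     ((c - x) powr - s / s - (d - x) powr - s / s)) ({c<..<d} \<inter> {y. \<delta> < \<bar>x - y\<bar>})"
  unfolding eventually_at_right_field
proof (intro exI conjI allI impI)
  fix \<delta>
  assume "x < c" "0 < \<delta>" "\<delta> < c - x"
  then have "{c<..<d} \<inter> {y. \<delta> < \<bar>x - y\<bar>} = {c<..<d}"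
    by auto
  then show "((\<lambda>y. 1 / \<bar>x - y\<bar> powr (1 + s)) has_integral
     ((c - x) powr - s / s - (d - x) powr - s / s)) ({c<..<d} \<inter> {y. \<delta> < \<bar>x - y\<bar>})"
    using has_integral_kernel_right [of x c d "1 + s"] s cd \<open>x < c\<close>
    by (simp add: diff_divide_distrib)
qed simp

lemma truncated_kernel_left:
  "d < x \<Longrightarrow> \<forall>\<^sub>F \<delta> in at_right 0. ((\<lambda>y. 1 / \<bar>x - y\<bar> powr (1 + s)) has_integral
     ((x - d) powr - s / s - (x - c) powr - s / s)) ({c<..<d} \<inter> {y. \<delta> < \<bar>x - y\<bar>})"
  unfolding eventually_at_right_field
proof (intro exI conjI allI impI)
  fix \<delta>
  assume "d < x" "0 < \<delta>" "\<delta> < x - d"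
  then have "{c<..<d} \<inter> {y. \<delta> < \<bar>x - y\<bar>} = {c<..<d}"
    by auto
  then show "((\<lambda>y. 1 / \<bar>x - y\<bar> powr (1 + s)) has_integral
     ((x - d) powr - s / s - (x - c) powr - s / s)) ({c<..<d} \<inter> {y. \<delta> < \<bar>x - y\<bar>})"
    using has_integral_kernel_left [of d x c "1 + s"] s cd \<open>d < x\<close>
    by (simp add: diff_divide_distrib)
qed simp

end

lemma riesz_potential_Un:
  assumes "((\<lambda>y. 1 / \<bar>x - y\<bar> powr \<alpha>) has_integral v) I" "((\<lambda>y. 1 / \<bar>x - y\<bar> powr \<alpha>) has_integral w) J"
    and "I \<inter> J = {}"
  shows "riesz_potential \<alpha> (I \<union> J) x = v + w"
  unfolding riesz_potential_def
  by (rule set_lebesgue_integral_nonneg(2) [OF has_integral_Un [OF assms(1,2)]]) (use assms in auto)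

context
  fixes p q p' q' s \<alpha> \<epsilon> :: real and E :: "real set" and f :: "real \<Rightarrow> real"
  assumes order: "p < q" "q < p'" "p' < q'"
    and s: "0 < s" and \<alpha>: "\<alpha> < 1"
    and E: "E = {p<..<q} \<union> {p'<..<q'}" and f: "f = endpoint_force s \<alpha> \<epsilon>"
begin

private lemma disjoint: "{p<..<q} \<inter> {p'<..<q'} = {}" "{p'<..<q'} \<inter> {p<..<q} = {}"
  using order by auto

text \<open>The curvature carries a factor 2 and the constant c is 2, so both parts merge into one
  function \<open>f\<close>. For \<epsilon> = 1 the value is the derivative of the energy when this
  endpoint moves outward.\<close>

lemma euler_lagrange_left_outer:
  "\<exists>k. has_frac_curvature s E p k \<and> k + 2 * \<epsilon> * riesz_potential \<alpha> E p = 2 * (f (q - p) + f (q' - p) - f (p' - p))"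
proof -
  have V: "riesz_potential \<alpha> E p = ((q - p) powr (1 - \<alpha>) - (p - p) powr (1 - \<alpha>)) / (1 - \<alpha>)
      + ((q' - p) powr (1 - \<alpha>) - (p' - p) powr (1 - \<alpha>)) / (1 - \<alpha>)"
    unfolding E using order \<alpha> by (intro riesz_potential_Un has_integral_kernel_right disjoint) auto
  have \<kappa>: "has_frac_curvature s E p
      (2 * ((q - p) powr - s / s - ((p' - p) powr - s / s - (q' - p) powr - s / s)))"
    unfolding E using order s
    by (intro has_frac_curvature_Un truncated_kernel_adjacent_right truncated_kernel_right disjoint) auto
  show ?thesis
    by (rule exI, rule conjI, rule \<kappa>) (simp add: V f endpoint_force_def diff_divide_distrib algebra_simps)
qed

lemma euler_lagrange_left_inner:
  "\<exists>k. has_frac_curvature s E q k \<and> k + 2 * \<epsilon> * riesz_potential \<alpha> E q = 2 * (f (q - p) + f (q' - q) - f (p' - q))"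
proof -
  have V: "riesz_potential \<alpha> E q = ((q - p) powr (1 - \<alpha>) - (q - q) powr (1 - \<alpha>)) / (1 - \<alpha>)
      + ((q' - q) powr (1 - \<alpha>) - (p' - q) powr (1 - \<alpha>)) / (1 - \<alpha>)"
    unfolding E using order \<alpha> by (intro riesz_potential_Un has_integral_kernel_right has_integral_kernel_left disjoint) auto
  have \<kappa>: "has_frac_curvature s E q
      (2 * ((q - p) powr - s / s - ((p' - q) powr - s / s - (q' - q) powr - s / s)))"
    unfolding E using order s
    by (intro has_frac_curvature_Un truncated_kernel_adjacent_left truncated_kernel_right disjoint) auto
  show ?thesis
    by (rule exI, rule conjI, rule \<kappa>) (simp add: V f endpoint_force_def diff_divide_distrib algebra_simps)
qed

lemma euler_lagrange_right_inner:
  "\<exists>k. has_frac_curvature s E p' k \<and> k + 2 * \<epsilon> * riesz_potential \<alpha> E p' = 2 * (f (q' - p') + f (p' - p) - f (p' - q))"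
proof -
  have V: "riesz_potential \<alpha> E p' = ((p' - p) powr (1 - \<alpha>) - (p' - q) powr (1 - \<alpha>)) / (1 - \<alpha>)
      + ((q' - p') powr (1 - \<alpha>) - (p' - p') powr (1 - \<alpha>)) / (1 - \<alpha>)"
    unfolding E using order \<alpha> by (intro riesz_potential_Un has_integral_kernel_right has_integral_kernel_left disjoint) auto
  have \<kappa>: "has_frac_curvature s E p'
      (2 * ((q' - p') powr - s / s - ((p' - q) powr - s / s - (p' - p) powr - s / s)))"
    \<comment> \<open>The component adjacent to the boundary point has to come first; here it is the
      right one.\<close>
    unfolding E Un_commute [of "{p<..<q}"] using order s
    by (intro has_frac_curvature_Un truncated_kernel_adjacent_right truncated_kernel_left disjoint) auto
  show ?thesis
    by (rule exI, rule conjI, rule \<kappa>) (simp add: V f endpoint_force_def diff_divide_distrib algebra_simps)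
qed

lemma euler_lagrange_right_outer:
  "\<exists>k. has_frac_curvature s E q' k \<and> k + 2 * \<epsilon> * riesz_potential \<alpha> E q' = 2 * (f (q' - p') + f (q' - p) - f (q' - q))"
proof -
  have V: "riesz_potential \<alpha> E q' = ((q' - p) powr (1 - \<alpha>) - (q' - q) powr (1 - \<alpha>)) / (1 - \<alpha>)
      + ((q' - p') powr (1 - \<alpha>) - (q' - q') powr (1 - \<alpha>)) / (1 - \<alpha>)"
    unfolding E using order \<alpha> by (intro riesz_potential_Un has_integral_kernel_left disjoint) auto
  have \<kappa>: "has_frac_curvature s E q'
      (2 * ((q' - p') powr - s / s - ((q' - q) powr - s / s - (q' - p) powr - s / s)))"
    unfolding E Un_commute [of "{p<..<q}"] using order s
    by (intro has_frac_curvature_Un truncated_kernel_adjacent_left truncated_kernel_left disjoint) auto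
  show ?thesis
    by (rule exI, rule conjI, rule \<kappa>) (simp add: V f endpoint_force_def diff_divide_distrib algebra_simps)
qed

end

lemma frontier_two_intervals_subset:
  fixes p q p' q' :: real
  shows "frontier ({p<..<q} \<union> {p'<..<q'}) \<subseteq> {p, q, p', q'}"
proof -
  have "frontier {a<..<b} \<subseteq> {a, b}" for a b :: real
    by (cases "a < b") (auto simp: frontier_def)
  then show ?thesis
    using frontier_Un_subset [of "{p<..<q}" "{p'<..<q'}"] by blast
qed

lemma twin_intervals_euler_lagrange:
  assumes "0 < A" "0 < L" "0 < s" "\<alpha> < 1"
    and balance: "endpoint_force s \<alpha> \<epsilon> A + endpoint_force s \<alpha> \<epsilon> (A + 2 * L) = 2 * endpoint_force s \<alpha> \<epsilon> (A + L)"
  shows "\<exists>\<mu>. euler_lagrange s \<alpha> \<epsilon> (twin_intervals A L) \<mu>"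
proof -
  let ?f = "endpoint_force s \<alpha> \<epsilon>" and ?p = "- A / 2 - L" and ?q = "- A / 2" and ?p' = "A / 2" and ?q' = "A / 2 + L"
  have order: "?p < ?q" "?q < ?p'" "?p' < ?q'"
    using assms by auto
  have gaps: "?q - ?p = L" "?q' - ?p' = L" "?q' - ?p = A + 2 * L" "?q' - ?q = A + L" "?p' - ?p = A + L" "?p' - ?q = A"
    by simp_all
  \<comment> \<open>Reflection leaves one value for the outer endpoints and one for the inner ones;
    their difference is the second difference of \<open>?f\<close>.\<close>
  have bal: "?f L + ?f (A + 2 * L) - ?f (A + L) = ?f L + ?f (A + L) - ?f A"
    using balance by simp
  note el = euler_lagrange_left_outer [OF order assms(3,4) refl refl, of \<epsilon>] euler_lagrange_left_inner [OF order assms(3,4) refl refl, of \<epsilon>]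
    euler_lagrange_right_inner [OF order assms(3,4) refl refl, of \<epsilon>] euler_lagrange_right_outer [OF order assms(3,4) refl refl, of \<epsilon>]
  have "euler_lagrange s \<alpha> \<epsilon> (twin_intervals A L) (2 * (?f L + ?f (A + L) - ?f A))"
    unfolding euler_lagrange_def twin_intervals_def
    using frontier_two_intervals_subset [of ?p ?q ?p' ?q'] el [unfolded gaps bal] by blast
  then show ?thesis
    by blast
qed

lemma bounded_twin_intervals: "bounded (twin_intervals A L)"
  by (simp add: twin_intervals_def)

lemma two_components_twin_intervals:
  assumes "0 < A" "0 < L"
  shows "two_components (twin_intervals A L)"
  unfolding two_components_def twin_intervals_def
  by (intro exI [of _ "{- A / 2 - L<..<- A / 2}"] exI [of _ "{A / 2<..<A / 2 + L}"])
     (use assms in \<open>auto simp: is_interval_oo\<close>)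

text \<open>The extreme points belong only to the closure, which has the same diameter.\<close>

lemma diameter_twin_intervals:
  assumes "0 < A" "0 < L"
  shows "A + 2 * L \<le> diameter (twin_intervals A L)"
proof -
  have "- A / 2 - L \<in> closure (twin_intervals A L)" "A / 2 + L \<in> closure (twin_intervals A L)"
    using assms by (auto simp: twin_intervals_def closure_Un)
  from diameter_bounded_bound [OF bounded_closure [OF bounded_twin_intervals] this]
  show ?thesis
    using assms by (simp add: diameter_closure bounded_twin_intervals dist_real_def)
qed

subsection \<open>Balancing the two intervals\<close>

text \<open>The mean value theorem is applied to r \<mapsto> f (r + L) - f r and then to f'.\<close>

lemma second_difference_mean_value:
  fixes f f' f'' :: "real \<Rightarrow> real"
  assumes "0 < L"
    and f: "\<And>r. a \<le> r \<Longrightarrow> (f has_real_derivative f' r) (at r)"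
    and f': "\<And>r. a \<le> r \<Longrightarrow> (f' has_real_derivative f'' r) (at r)"
  obtains \<eta> where "a < \<eta>" "\<eta> < a + 2 * L" "f a + f (a + 2 * L) - 2 * f (a + L) = L\<^sup>2 * f'' \<eta>"
proof -
  have "\<exists>\<xi>. a < \<xi> \<and> \<xi> < a + L \<and> (f (a + L + L) - f (a + L)) - (f (a + L) - f a) = (a + L - a) * (f' (\<xi> + L) - f' \<xi>)"
  proof (rule MVT2)
    fix r
    assume "a \<le> r" "r \<le> a + L"
    then show "((\<lambda>r. f (r + L) - f r) has_real_derivative f' (r + L) - f' r) (at r)"
      using \<open>0 < L\<close> f [of "r + L"] by (intro DERIV_diff f) (auto simp: DERIV_shift)
  qed (use \<open>0 < L\<close> in simp)
  then obtain \<xi> where \<xi>: "a < \<xi>" "\<xi> < a + L"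
    "(f (a + L + L) - f (a + L)) - (f (a + L) - f a) = L * (f' (\<xi> + L) - f' \<xi>)"
    by auto
  have "\<exists>\<eta>. \<xi> < \<eta> \<and> \<eta> < \<xi> + L \<and> f' (\<xi> + L) - f' \<xi> = (\<xi> + L - \<xi>) * f'' \<eta>"
    by (rule MVT2) (use \<xi> \<open>0 < L\<close> f' in auto)
  then obtain \<eta> where \<eta>: "\<xi> < \<eta>" "\<eta> < \<xi> + L" "f' (\<xi> + L) - f' \<xi> = L * f'' \<eta>"
    by auto
  have "a + L + L = a + 2 * L"
    by simp
  then have "f a + f (a + 2 * L) - 2 * f (a + L) = L\<^sup>2 * f'' \<eta>"
    using \<xi>(3) \<eta>(3) by (simp add: power2_eq_square algebra_simps)
  with \<xi> \<eta> show thesis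
    by (intro that [of \<eta>]) auto
qed

text \<open>The second derivative is written as a positive power times a bracket, so that its sign
  is decided by comparing \<eta> with the zero of the bracket.\<close>

lemma endpoint_force_second_difference:
  assumes "0 < a" "0 < L" "0 < s" "\<alpha> < 1"
  obtains \<eta> where "a < \<eta>" "\<eta> < a + 2 * L"
    "endpoint_force s \<alpha> \<epsilon> a + endpoint_force s \<alpha> \<epsilon> (a + 2 * L) - 2 * endpoint_force s \<alpha> \<epsilon> (a + L)
      = L\<^sup>2 * (\<eta> powr (- s - 2) * ((1 + s) - \<epsilon> * \<alpha> * \<eta> powr (1 + s - \<alpha>)))"
proof (rule second_difference_mean_value [OF \<open>0 < L\<close>])
  fix r
  assume "a \<le> r"
  then have r: "0 < r"
    using assms by simp
  show "(endpoint_force s \<alpha> \<epsilon> has_real_derivative - (r powr (- s - 1)) + \<epsilon> * r powr - \<alpha>) (at r)"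
    unfolding endpoint_force_def [abs_def]
    using DERIV_add [OF DERIV_cdivide [OF has_real_derivative_powr [OF r, of "- s"], of s]
      DERIV_cmult [OF DERIV_cdivide [OF has_real_derivative_powr [OF r, of "1 - \<alpha>"], of "1 - \<alpha>"], of \<epsilon>]] assms
    by simp
  have "- s - 2 + (1 + s - \<alpha>) = - \<alpha> - 1"
    by simp
  then have "r powr (- s - 2) * r powr (1 + s - \<alpha>) = r powr (- \<alpha> - 1)"
    by (metis powr_add)
  moreover have "- s - 1 - 1 = - s - 2"
    by simp
  ultimately show "((\<lambda>r. - (r powr (- s - 1)) + \<epsilon> * r powr - \<alpha>) has_real_derivative
      r powr (- s - 2) * ((1 + s) - \<epsilon> * \<alpha> * r powr (1 + s - \<alpha>))) (at r)"
    using DERIV_add [OF DERIV_minus [OF has_real_derivative_powr [OF r, of "- s - 1"]]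
      DERIV_cmult [OF has_real_derivative_powr [OF r, of "- \<alpha>"], of \<epsilon>]]
    by (simp add: algebra_simps)
qed (use that in auto)

text \<open>The assumption \<open>2 * L < R\<close> makes the left end R - 2 L of the search
  interval positive. The intermediate point for \<open>a = R\<close> lies above R, the one for
  \<open>a = R - 2 * L\<close> below it, so the two signs are opposite.\<close>

lemma exists_balanced_gap:
  assumes "0 < s" "0 < \<alpha>" "\<alpha> < 1" "0 < \<epsilon>" "0 < L"
  defines "R \<equiv> ((1 + s) / (\<alpha> * \<epsilon>)) powr (1 / (1 + s - \<alpha>))"
  assumes "2 * L < R"
  shows "\<exists>A>0. R \<le> A + 2 * L \<and>
    endpoint_force s \<alpha> \<epsilon> A + endpoint_force s \<alpha> \<epsilon> (A + 2 * L) = 2 * endpoint_force s \<alpha> \<epsilon> (A + L)"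
proof -
  let ?f = "endpoint_force s \<alpha> \<epsilon>"
  let ?D = "\<lambda>a. ?f a + ?f (a + 2 * L) - 2 * ?f (a + L)"
  have \<beta>: "0 < 1 + s - \<alpha>"
    using assms by simp
  have R: "R powr (1 + s - \<alpha>) = (1 + s) / (\<alpha> * \<epsilon>)"
    using assms by (simp add: R_def powr_powr)
  have "?D R \<le> 0"
  proof -
    obtain \<eta> where \<eta>: "R < \<eta>" "?D R = L\<^sup>2 * (\<eta> powr (- s - 2) * ((1 + s) - \<epsilon> * \<alpha> * \<eta> powr (1 + s - \<alpha>)))"
      using endpoint_force_second_difference [of R L s \<alpha> \<epsilon>] assms by auto
    have "R powr (1 + s - \<alpha>) \<le> \<eta> powr (1 + s - \<alpha>)"
      using \<eta> assms \<beta> by (intro powr_mono2) auto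
    then have "1 + s \<le> \<epsilon> * \<alpha> * \<eta> powr (1 + s - \<alpha>)"
      unfolding R using assms by (simp add: field_simps)
    then show ?thesis
      unfolding \<eta>(2) by (intro mult_nonneg_nonpos) auto
  qed
  moreover have "0 \<le> ?D (R - 2 * L)"
  proof -
    have "0 < R - 2 * L" "R - 2 * L + 2 * L = R"
      using assms by auto
    then obtain \<eta> where \<eta>: "0 < \<eta>" "\<eta> < R"
      "?D (R - 2 * L) = L\<^sup>2 * (\<eta> powr (- s - 2) * ((1 + s) - \<epsilon> * \<alpha> * \<eta> powr (1 + s - \<alpha>)))"
      using endpoint_force_second_difference [of "R - 2 * L" L s \<alpha> \<epsilon>] assms(1,3,5)
      by (metis less_trans)
    have "\<eta> powr (1 + s - \<alpha>) \<le> R powr (1 + s - \<alpha>)"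
      using \<eta> assms \<beta> by (intro powr_mono2) auto
    then have "\<epsilon> * \<alpha> * \<eta> powr (1 + s - \<alpha>) \<le> 1 + s"
      unfolding R using assms by (simp add: field_simps)
    then show ?thesis
      unfolding \<eta>(3) by (intro mult_nonneg_nonneg) auto
  qed
  moreover have "continuous_on {R - 2 * L..R} ?D"
    unfolding endpoint_force_def using assms by (intro continuous_intros) auto
  ultimately obtain A where "R - 2 * L \<le> A" "A \<le> R" "?D A = 0"
    using IVT2' [of ?D R 0 "R - 2 * L"] assms by auto
  then show ?thesis
    using assms by (intro exI [of _ A]) auto
qed

theorem theorem2:
  fixes s \<alpha> :: real
  assumes "0 < s" "s < 1" "0 < \<alpha>" "\<alpha> < 1"
  shows "(\<exists>mbar > 0. \<exists>C > 0. \<forall>m. 0 < m \<and> m < mbar \<longrightarrow>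
            (\<exists>E. bounded E \<and> volume_constrained_critical s \<alpha> E \<and>
                 emeasure lebesgue E = ennreal m \<and> two_components E \<and> diameter E \<ge> C))
       \<and> (\<exists>ebar > 0. \<exists>C > 0. \<exists>E :: real \<Rightarrow> real set. \<exists>\<mu> :: real \<Rightarrow> real.
            (\<forall>\<epsilon>. 0 < \<epsilon> \<and> \<epsilon> < ebar \<longrightarrow>
                 bounded (E \<epsilon>) \<and> emeasure lebesgue (E \<epsilon>) = 1 \<and> two_components (E \<epsilon>) \<and>
                 euler_lagrange s \<alpha> \<epsilon> (E \<epsilon>) (\<mu> \<epsilon>) \<and>
                 diameter (E \<epsilon>) \<ge> C * \<epsilon> powr (- (1 / (1 + s - \<alpha>)))) \<and>
            \<not> (\<exists>R. \<forall>\<epsilon>. 0 < \<epsilon> \<and> \<epsilon> < ebar \<longrightarrow> diameter (E \<epsilon>) \<le> R))"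
proof -
  define \<beta> where "\<beta> = 1 + s - \<alpha>"
  \<comment> \<open>The critical distance R at \<epsilon> = 1. It serves as the bound on m, because
    2 L = m has to stay below R, and as the bound on the diameter.\<close>
  define C where "C = ((1 + s) / \<alpha>) powr (1 / \<beta>)"
  have pos: "0 < \<beta>" "0 < C" "0 < (1 + s) / \<alpha>"
    using assms by (auto simp: \<beta>_def C_def)
  have critical: "\<exists>E. bounded E \<and> volume_constrained_critical s \<alpha> E \<and>
      emeasure lebesgue E = ennreal m \<and> two_components E \<and> diameter E \<ge> C" if m: "0 < m" "m < C" for m
  proof -
    obtain A where A: "0 < A" "C \<le> A + 2 * (m / 2)"
      "endpoint_force s \<alpha> 1 A + endpoint_force s \<alpha> 1 (A + 2 * (m / 2)) = 2 * endpoint_force s \<alpha> 1 (A + m / 2)"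
      using exists_balanced_gap [of s \<alpha> 1 "m / 2"] assms m unfolding C_def \<beta>_def by auto
    show ?thesis
    proof (intro exI [of _ "twin_intervals A (m / 2)"] conjI)
      show "volume_constrained_critical s \<alpha> (twin_intervals A (m / 2))"
        by (rule twin_intervals_critical [OF _ _ assms A(3)]) (use A m in auto)
    qed (use A m emeasure_twin_intervals [of A "m / 2"] diameter_twin_intervals [of A "m / 2"]
          in \<open>auto simp: bounded_twin_intervals two_components_twin_intervals\<close>)
  qed
  have "\<exists>E \<mu>. bounded E \<and> emeasure lebesgue E = 1 \<and> two_components E \<and> euler_lagrange s \<alpha> \<epsilon> E \<mu> \<and>
      diameter E \<ge> C * \<epsilon> powr (- (1 / \<beta>))" if eps: "0 < \<epsilon>" "\<epsilon> < (1 + s) / \<alpha>" for \<epsilon>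
  proof -
    have R: "((1 + s) / (\<alpha> * \<epsilon>)) powr (1 / \<beta>) = C * \<epsilon> powr (- (1 / \<beta>))"
      using assms eps powr_divide [of "(1 + s) / \<alpha>" \<epsilon> "1 / \<beta>"]
      by (simp add: C_def powr_minus_divide)
    \<comment> \<open>The threshold for \<epsilon> says exactly that this base exceeds 1, hence that
      R > 1 = 2 L.\<close>
    have "1 < (1 + s) / (\<alpha> * \<epsilon>)"
      using assms eps by (simp add: field_simps)
    then have "1 powr (1 / \<beta>) < ((1 + s) / (\<alpha> * \<epsilon>)) powr (1 / \<beta>)"
      using pos by (intro powr_less_mono2) auto
    then obtain A where A: "0 < A" "C * \<epsilon> powr (- (1 / \<beta>)) \<le> A + 2 * (1 / 2)"
      "endpoint_force s \<alpha> \<epsilon> A + endpoint_force s \<alpha> \<epsilon> (A + 2 * (1 / 2)) = 2 * endpoint_force s \<alpha> \<epsilon> (A + 1 / 2)"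
      using exists_balanced_gap [of s \<alpha> \<epsilon> "1 / 2"] assms eps unfolding \<beta>_def [symmetric] R by auto
    obtain \<mu> where "euler_lagrange s \<alpha> \<epsilon> (twin_intervals A (1 / 2)) \<mu>"
      using twin_intervals_euler_lagrange [OF _ _ _ _ A(3)] A assms by auto
    then show ?thesis
      using A emeasure_twin_intervals [of A "1 / 2"] diameter_twin_intervals [of A "1 / 2"]
      by (intro exI [of _ "twin_intervals A (1 / 2)"] exI [of _ \<mu>])
         (auto simp: bounded_twin_intervals two_components_twin_intervals)
  qed
  \<comment> \<open>The sets are fixed as one family in \<epsilon>, because unboundedness of the
    diameter is a claim about that same family.\<close>
  then obtain E \<mu> where E: "\<And>\<epsilon>. 0 < \<epsilon> \<and> \<epsilon> < (1 + s) / \<alpha> \<Longrightarrow>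
      bounded (E \<epsilon>) \<and> emeasure lebesgue (E \<epsilon>) = 1 \<and> two_components (E \<epsilon>) \<and>
      euler_lagrange s \<alpha> \<epsilon> (E \<epsilon>) (\<mu> \<epsilon>) \<and> diameter (E \<epsilon>) \<ge> C * \<epsilon> powr (- (1 / \<beta>))"
    by metis
  have unbounded: "\<not> (\<exists>R. \<forall>\<epsilon>. 0 < \<epsilon> \<and> \<epsilon> < (1 + s) / \<alpha> \<longrightarrow> diameter (E \<epsilon>) \<le> R)"
  proof (rule notI, elim exE)
    fix R
    assume R: "\<forall>\<epsilon>. 0 < \<epsilon> \<and> \<epsilon> < (1 + s) / \<alpha> \<longrightarrow> diameter (E \<epsilon>) \<le> R"
    \<comment> \<open>Chosen so that C Q = \<bar>R\<bar> + 1 > R. Taking \<epsilon> at most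
      Q^-\<beta> makes \<epsilon>^(-1/\<beta>) at least Q, and the other term of the minimum keeps
      \<epsilon> admissible.\<close>
    define Q where "Q = (\<bar>R\<bar> + 1) / C"
    define \<epsilon> where "\<epsilon> = min ((1 + s) / \<alpha> / 2) (Q powr - \<beta>)"
    have Q: "0 < Q"
      using pos by (simp add: Q_def)
    have \<epsilon>: "0 < \<epsilon>" "\<epsilon> < (1 + s) / \<alpha>"
      using pos Q by (auto simp: \<epsilon>_def min_def)
    have "Q = (Q powr - \<beta>) powr (- (1 / \<beta>))"
      using pos Q by (simp add: powr_powr)
    also have "\<dots> \<le> \<epsilon> powr (- (1 / \<beta>))"
      using pos \<epsilon> by (intro powr_mono2') (auto simp: \<epsilon>_def)
    finally have "C * Q \<le> diameter (E \<epsilon>)"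
      using E [of \<epsilon>] \<epsilon> pos by (meson mult_left_mono less_imp_le order_trans)
    then show False
      using R \<epsilon> pos by (fastforce simp: Q_def)
  qed
  show ?thesis
  proof (rule conjI)
    show "\<exists>mbar > 0. \<exists>C > 0. \<forall>m. 0 < m \<and> m < mbar \<longrightarrow>
            (\<exists>E. bounded E \<and> volume_constrained_critical s \<alpha> E \<and>
                 emeasure lebesgue E = ennreal m \<and> two_components E \<and> diameter E \<ge> C)"
      by (rule exI [of _ C], rule conjI [OF pos(2)], rule exI [of _ C], rule conjI [OF pos(2)])
         (use critical in auto)
    show "\<exists>ebar > 0. \<exists>C > 0. \<exists>E :: real \<Rightarrow> real set. \<exists>\<mu> :: real \<Rightarrow> real.
            (\<forall>\<epsilon>. 0 < \<epsilon> \<and> \<epsilon> < ebar \<longrightarrow>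
                 bounded (E \<epsilon>) \<and> emeasure lebesgue (E \<epsilon>) = 1 \<and> two_components (E \<epsilon>) \<and>
                 euler_lagrange s \<alpha> \<epsilon> (E \<epsilon>) (\<mu> \<epsilon>) \<and>
                 diameter (E \<epsilon>) \<ge> C * \<epsilon> powr (- (1 / (1 + s - \<alpha>)))) \<and>
            \<not> (\<exists>R. \<forall>\<epsilon>. 0 < \<epsilon> \<and> \<epsilon> < ebar \<longrightarrow> diameter (E \<epsilon>) \<le> R)"
      by (rule exI [of _ "(1 + s) / \<alpha>"], rule conjI [OF pos(3)], rule exI [of _ C], rule conjI [OF pos(2)],
          rule exI [of _ E], rule exI [of _ \<mu>]) (use E unbounded in \<open>auto simp: \<beta>_def\<close>)
  qed
qed

end
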